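(* Consider the infinite horizon optimal control problem of minimizing $J_\infty(x_0,u)$ over $u\in\mathbb{U}^\infty(x_0)$ with discount factor $\beta\in(0,1)$, and assume that the system is locally discounted strictly dissipative at an equilibrium $(x_l^\beta,u_l^\beta)$, $x_l^\beta\in\mathbb{X}_{\mathcal N}\subset\mathbb{X}$, with supply rate $s(x,u)=\ell(x,u)-\ell(x_l^\beta,u_l^\beta)$ and storage function $\lambda$. Consider a subset $\mathbb{X}_{inv}\subset\mathbb{X}_{\mathcal N}$ such that all optimal trajectories $x^*(\cdot,x_0)$ with $x_0\in\mathbb{X}_{inv}$ satisfy $x^*(k,x_0)\in\mathbb{X}_{inv}$ for all $k\ge0$. Suppose that there are a function $\alpha_V\in\mathcal{K}_\infty$ and a constant $C\ge1$ with $C<1/(1-\beta)$ such that $$\widetilde V_\infty(x)\le\alpha_V(\|x-x_l^\beta\|)\quad\text{and}\quad\widetilde V_\infty(x)\le C\inf_{u\in\mathbb{U}}\tilde\ell(x,u)\qquad\text{for all }x\in\mathbb{X}_{inv}.$$ Then the optimal control problem has the following turnpike property on $\mathbb{X}_{inv}$: for each $\varepsilon>0$ and each bounded set $\mathbb{X}_b\subset\mathbb{X}_{inv}$ there exists a constant $P>0$ such that for each $M\in\mathbb{N}$ there is a $\delta>0$ such that for all $x_0\in\mathbb{X}_b$ and all $u\in\mathbb{U}^\infty(x_0)$ with $J_\infty(x_0,u)\le V_\infty(x_0)+\delta$ and $x_u(k,x_0)\in\mathbb{X}_{inv}$ for all $k\in\{0,\dots,M\}$, the set $$\mathcal{Q}(x_0,u,\varepsilon,M,\beta):=\{k\in\{0,\dots,M\}\mid\|x_u(k,x_0)-x_l^\beta\|\ge\varepsilon\}$$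 has at most $P$ elements.
   Context: System: $x(k+1)=f(x(k),u(k))$, $x(0)=x_0$, with $f:X\times U\to X$ and $X,U$ normed spaces. Constraints: $\mathbb{Y}\subset X\times U$, $\mathbb{X}:=\{x\in X\mid\exists u\in U:(x,u)\in\mathbb{Y}\}$, $\mathbb{U}:=\{u\in U\mid\exists x\in X:(x,u)\in\mathbb{Y}\}$. $x_u(k,x_0)$ denotes the trajectory with initial value $x_0$ and control sequence $u$. $\mathbb{U}^\infty(x_0)$ is the set of all control sequences $u\in\mathbb{U}^\infty$ with $(x_u(k,x_0),u(k))\in\mathbb{Y}$ for all $k\in\mathbb{N}_0$; it is assumed nonempty for every $x_0\in\mathbb{X}$. An equilibrium is a pair $(x_e,u_e)\in\mathbb{Y}$ with $f(x_e,u_e)=x_e$. For the discount factor $\beta$ and stage cost $\ell:\mathbb{Y}\to\mathbb{R}$: $J_\infty(x_0,u)=\sum_{k=0}^\infty\beta^k\ell(x_u(k,x_0),u(k))$ and $V_\infty(x_0):=\min_{u\in\mathbb{U}^\infty(x_0)}J_\infty(x_0,u)$. A control $u^*\in\mathbb{U}^\infty(x_0)$ is optimal if $J_\infty(x_0,u^* )=V_\infty(x_0)$; its trajectory is an optimal trajectory, denoted $x^*(\cdot,x_0)$. $\mathcal{K}_\infty$ is the set of continuous, strictly increasing, unbounded functions $\alpha:[0,\infty)\to[0,\infty)$ with $\alpha(0)=0$. The system is locally discounted strictly dissipative at the equilibrium $(x_l^\beta,u_l^\beta)$ with supply rate $s:\mathbb{Y}\to\mathbb{R}$ if there exist a storage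 function $\lambda:\mathbb{X}\to\mathbb{R}$ bounded from below with $\lambda(x_l^\beta)=0$ and a function $\alpha_\beta\in\mathcal{K}_\infty$ such that $$s(x,u)+\lambda(x)-\beta\lambda(f(x,u))\ge\alpha_\beta(\|x-x_l^\beta\|)$$ for all $(x,u)\in\mathbb{X}_{\mathcal N}\times\mathbb{U}$ (with $(x,u)\in\mathbb{Y}$ and $f(x,u)\in\mathbb{X}$, so that the left side is defined), where $\mathbb{X}_{\mathcal N}\subset\mathbb{X}$ is a neighbourhood of $x_l^\beta$. Rotated quantities: $\tilde\ell(x,u):=\ell(x,u)-\ell(x_l^\beta,u_l^\beta)+\lambda(x)-\beta\lambda(f(x,u))$; $\widetilde J_\infty(x_0,u):=\sum_{k=0}^\infty\beta^k\tilde\ell(x_u(k,x_0),u(k))$; $\widetilde V_\infty(x_0):=\min_{u\in\mathbb{U}^\infty(x_0)}\widetilde J_\infty(x_0,u)$. The infimum $\inf_{u\in\mathbb{U}}\tilde\ell(x,u)$ is over those $u$ for which $\tilde\ell(x,u)$ is defined.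
   Formalization: Adds the assumption that β^k λ(x_u(k,x_0)) → 0 along every control u minimizing the rotated cost from x_0 in X_inv (automatic if λ is bounded on X); without it the claim fails when λ is unbounded above. *)

theory Defs
  imports "HOL-Analysis.Analysis"
begin

text \<open>
  Control systems \<open>x(k+1) = f (x(k)) (u(k))\<close> under a joint constraint set \<open>Y\<close>. Stage costs
  \<open>c :: 'x \<Rightarrow> 'u \<Rightarrow> real\<close> and storage functions \<open>lam :: 'x \<Rightarrow> real\<close> are total in the
  logic, but are only ever evaluated on \<open>Y\<close> and on \<open>state_set Y\<close>, respectively.
\<close>

definition state_set :: "('x \<times> 'u) set \<Rightarrow> 'x set" where
  "state_set Y = {x. \<exists>u. (x, u) \<in> Y}"

definition control_set :: "('x \<times> 'u) set \<Rightarrow> 'u set" where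
  "control_set Y = {u. \<exists>x. (x, u) \<in> Y}"

primrec traj :: "('x \<Rightarrow> 'u \<Rightarrow> 'x) \<Rightarrow> (nat \<Rightarrow> 'u) \<Rightarrow> 'x \<Rightarrow> nat \<Rightarrow> 'x" where
  "traj f u x0 0 = x0"
| "traj f u x0 (Suc k) = f (traj f u x0 k) (u k)"

definition admissible :: "('x \<Rightarrow> 'u \<Rightarrow> 'x) \<Rightarrow> ('x \<times> 'u) set \<Rightarrow> 'x \<Rightarrow> (nat \<Rightarrow> 'u) set" where
  "admissible f Y x0 =
     {u. (\<forall>k. u k \<in> control_set Y) \<and> (\<forall>k. (traj f u x0 k, u k) \<in> Y)}"

definition equilibrium :: "('x \<Rightarrow> 'u \<Rightarrow> 'x) \<Rightarrow> ('x \<times> 'u) set \<Rightarrow> 'x \<Rightarrow> 'u \<Rightarrow> bool" where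
  "equilibrium f Y xe ue \<longleftrightarrow> (xe, ue) \<in> Y \<and> f xe ue = xe"

text \<open>
  The discounted series is taken in the extended reals, so that a control may have infinite
  cost. It is meaningful only if the partial sums converge there; that they do, and that the
  infimum \<open>V_inf\<close> is a minimum, is recorded in \<open>well_posed\<close>.
\<close>

definition J_inf ::
  "('x \<Rightarrow> 'u \<Rightarrow> 'x) \<Rightarrow> real \<Rightarrow> ('x \<Rightarrow> 'u \<Rightarrow> real) \<Rightarrow> 'x \<Rightarrow> (nat \<Rightarrow> 'u) \<Rightarrow> ereal" where
  "J_inf f \<beta> c x0 u = (\<Sum>k. ereal (\<beta> ^ k * c (traj f u x0 k) (u k)))"

definition V_inf ::
  "('x \<Rightarrow> 'u \<Rightarrow> 'x) \<Rightarrow> ('x \<times> 'u) set \<Rightarrow> real \<Rightarrow> ('x \<Rightarrow> 'u \<Rightarrow> real) \<Rightarrow> 'x \<Rightarrow> ereal" where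
  "V_inf f Y \<beta> c x0 = (INF u\<in>admissible f Y x0. J_inf f \<beta> c x0 u)"

definition optimal ::
  "('x \<Rightarrow> 'u \<Rightarrow> 'x) \<Rightarrow> ('x \<times> 'u) set \<Rightarrow> real \<Rightarrow> ('x \<Rightarrow> 'u \<Rightarrow> real) \<Rightarrow> 'x \<Rightarrow> (nat \<Rightarrow> 'u) \<Rightarrow> bool"
  where
  "optimal f Y \<beta> c x0 u \<longleftrightarrow>
     u \<in> admissible f Y x0 \<and> J_inf f \<beta> c x0 u = V_inf f Y \<beta> c x0"

definition well_posed ::
  "('x \<Rightarrow> 'u \<Rightarrow> 'x) \<Rightarrow> ('x \<times> 'u) set \<Rightarrow> real \<Rightarrow> ('x \<Rightarrow> 'u \<Rightarrow> real) \<Rightarrow> 'x \<Rightarrow> bool" where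
  "well_posed f Y \<beta> c x0 \<longleftrightarrow>
     (\<forall>u\<in>admissible f Y x0. summable (\<lambda>k. ereal (\<beta> ^ k * c (traj f u x0 k) (u k)))) \<and>
     (\<exists>u. optimal f Y \<beta> c x0 u)"

definition class_K_inf :: "(real \<Rightarrow> real) set" where
  "class_K_inf =
     {\<alpha>. \<alpha> \<in> {0..} \<rightarrow> {0..} \<and> continuous_on {0..} \<alpha> \<and> strict_mono_on {0..} \<alpha> \<and>
         \<not> bounded (\<alpha> ` {0..}) \<and> \<alpha> 0 = 0}"

text \<open>
  \<open>XN\<close> is a neighbourhood of \<open>xl\<close> relative to the state constraint set. This includes the case
  of a neighbourhood in the whole space that happens to lie in \<open>state_set Y\<close>.
\<close>

definition loc_disc_strictly_dissipative ::
  "('x::real_normed_vector \<Rightarrow> 'u \<Rightarrow> 'x) \<Rightarrow> ('x \<times> 'u) set \<Rightarrow> real \<Rightarrow> 'x \<Rightarrow> 'u \<Rightarrow>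
   ('x \<Rightarrow> 'u \<Rightarrow> real) \<Rightarrow> 'x set \<Rightarrow> ('x \<Rightarrow> real) \<Rightarrow> bool" where
  "loc_disc_strictly_dissipative f Y \<beta> xl ul s XN lam \<longleftrightarrow>
     equilibrium f Y xl ul \<and>
     XN \<subseteq> state_set Y \<and>
     (\<exists>T. openin (top_of_set (state_set Y)) T \<and> xl \<in> T \<and> T \<subseteq> XN) \<and>
     bdd_below (lam ` state_set Y) \<and> lam xl = 0 \<and>
     (\<exists>\<alpha>\<in>class_K_inf. \<forall>x\<in>XN. \<forall>u\<in>control_set Y.
        (x, u) \<in> Y \<and> f x u \<in> state_set Y \<longrightarrow>
        s x u + lam x - \<beta> * lam (f x u) \<ge> \<alpha> (norm (x - xl)))"

definition rotated_cost ::
  "('x \<Rightarrow> 'u \<Rightarrow> 'x) \<Rightarrow> real \<Rightarrow> ('x \<Rightarrow> 'u \<Rightarrow> real) \<Rightarrow> ('x \<Rightarrow> real) \<Rightarrow> 'x \<Rightarrow> 'u \<Rightarrow>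
   'x \<Rightarrow> 'u \<Rightarrow> real" where
  "rotated_cost f \<beta> l lam xl ul x u = l x u - l xl ul + lam x - \<beta> * lam (f x u)"

text \<open>The controls for which the rotated cost at \<open>x\<close> is defined, i.e. involves \<open>l\<close> only on
  \<open>Y\<close> and \<open>lam\<close> only on \<open>state_set Y\<close>.\<close>

definition rotated_controls ::
  "('x \<Rightarrow> 'u \<Rightarrow> 'x) \<Rightarrow> ('x \<times> 'u) set \<Rightarrow> 'x \<Rightarrow> 'u set" where
  "rotated_controls f Y x = {u \<in> control_set Y. (x, u) \<in> Y \<and> f x u \<in> state_set Y}"

definition far_times ::
  "('x::real_normed_vector \<Rightarrow> 'u \<Rightarrow> 'x) \<Rightarrow> 'x \<Rightarrow> 'x \<Rightarrow> (nat \<Rightarrow> 'u) \<Rightarrow> real \<Rightarrow> nat \<Rightarrow> nat set"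
  where
  "far_times f xl x0 u \<epsilon> M = {k \<in> {0..M}. norm (traj f u x0 k - xl) \<ge> \<epsilon>}"

definition turnpike_on ::
  "('x::real_normed_vector \<Rightarrow> 'u \<Rightarrow> 'x) \<Rightarrow> ('x \<times> 'u) set \<Rightarrow> real \<Rightarrow> ('x \<Rightarrow> 'u \<Rightarrow> real) \<Rightarrow>
   'x \<Rightarrow> 'x set \<Rightarrow> bool" where
  "turnpike_on f Y \<beta> l xl Xinv \<longleftrightarrow>
     (\<forall>\<epsilon>>0. \<forall>Xb. bounded Xb \<and> Xb \<subseteq> Xinv \<longrightarrow>
       (\<exists>P::nat. P > 0 \<and> (\<forall>M::nat. \<exists>\<delta>::real. \<delta> > 0 \<and>
         (\<forall>x0\<in>Xb. \<forall>u\<in>admissible f Y x0.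
            J_inf f \<beta> l x0 u \<le> V_inf f Y \<beta> l x0 + ereal \<delta> \<and>
            (\<forall>k\<in>{0..M}. traj f u x0 k \<in> Xinv) \<longrightarrow>
            card (far_times f xl x0 u \<epsilon> M) \<le> P))))"

end

theory Submission
  imports Defs
begin

text \<open>
  Telescoping the storage function turns the rotated cost of a control into the original cost plus
  the constant \<open>lam x0 - l xl ul / (1 - \<beta>)\<close> minus \<open>lim \<beta>^k * lam (x k)\<close>. That limit is nonnegative
  because \<open>lam\<close> is bounded below, and zero for minimizers of the rotated problem. Hence the two
  value functions differ by this constant, and a control that is \<open>\<delta>\<close>-optimal for the original
  problem is \<open>\<delta>\<close>-optimal for the rotated one. By dynamic programming its \<open>k\<close>-th tail is
  \<open>\<delta> / \<beta>^k\<close>-optimal. As \<open>V \<le> C * lt\<close>, the rotated value function \<open>V\<close> then contracts along the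
  trajectory with factor \<open>q = (1 - 1 / C) / \<beta> < 1\<close>, up to errors \<open>\<delta> / \<beta>^(k + 1)\<close>. Since \<open>V\<close>
  dominates \<open>\<alpha> (norm (x - xl))\<close>, the state is \<open>\<epsilon>\<close>-close to \<open>xl\<close> after a time independent of \<open>M\<close>,
  provided that \<open>\<delta>\<close> is small compared to \<open>\<beta>^M / M\<close>.
\<close>

section \<open>Shifting and concatenating controls\<close>

lemma traj_tail: "traj f (\<lambda>k. u (Suc k)) (f x (u 0)) k = traj f u x (Suc k)"
  by (induction k) auto

lemma traj_shift: "traj f (\<lambda>j. u (j + n)) (traj f u x n) k = traj f u x (k + n)"
  by (induction k) auto

lemma traj_case_nat: "traj f (case_nat a v) x (Suc k) = traj f v (f x a) k"
  by (induction k) auto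

lemma admissible_shift:
  assumes "u \<in> admissible f Y x"
  shows "(\<lambda>j. u (j + n)) \<in> admissible f Y (traj f u x n)"
  using assms by (auto simp: admissible_def traj_shift)

text \<open>Supplies the competitor for Bellman's inequality: apply \<open>a\<close> first, then
  follow \<open>v\<close>.\<close>

lemma admissible_case_nat:
  assumes "(x, a) \<in> Y" "v \<in> admissible f Y (f x a)"
  shows "case_nat a v \<in> admissible f Y x"
proof -
  have "a \<in> control_set Y"
    using assms(1) by (auto simp: control_set_def)
  moreover have "(traj f (case_nat a v) x k, case_nat a v k) \<in> Y" for k
    using assms by (cases k) (auto simp: admissible_def traj_case_nat simp del: traj.simps(2))
  ultimately show ?thesis
    using assms(2) by (auto simp: admissible_def split: nat.split)
qed

lemma admissible_traj_state_set:
  assumes "u \<in> admissible f Y x"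
  shows "traj f u x k \<in> state_set Y"
  using assms by (auto simp: admissible_def state_set_def)

text \<open>Admissibility at time \<open>k + 1\<close> puts the successor state into
  \<open>state_set Y\<close>, so the rotated cost is defined all along an admissible
  trajectory.\<close>

lemma admissible_rotated_controls:
  assumes "u \<in> admissible f Y x"
  shows "u k \<in> rotated_controls f Y (traj f u x k)"
  using assms admissible_traj_state_set[OF assms, of "Suc k"]
  by (auto simp: rotated_controls_def admissible_def)

section \<open>Discounted series and dynamic programming\<close>

lemma well_posed_optimal:
  assumes "well_posed f Y \<beta> c x"
  obtains u where "u \<in> admissible f Y x" "J_inf f \<beta> c x u = V_inf f Y \<beta> c x"
  using assms by (auto simp: well_posed_def optimal_def)

lemma V_inf_le_J_inf:
  assumes "u \<in> admissible f Y x"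
  shows "V_inf f Y \<beta> c x \<le> J_inf f \<beta> c x u"
  unfolding V_inf_def using assms by (rule INF_lower)

text \<open>The partial sums are real sums lifted to \<open>ereal\<close>: telescoping takes place
  in the reals, while the limit may be infinite.\<close>

lemma well_posed_LIMSEQ:
  assumes "well_posed f Y \<beta> c x" "u \<in> admissible f Y x"
  shows "(\<lambda>n. ereal (\<Sum>k<n. \<beta> ^ k * c (traj f u x k) (u k))) \<longlonglongrightarrow> J_inf f \<beta> c x u"
proof -
  have "summable (\<lambda>k. ereal (\<beta> ^ k * c (traj f u x k) (u k)))"
    using assms by (simp add: well_posed_def)
  then show ?thesis
    unfolding J_inf_def by (simp add: summable_LIMSEQ flip: sum_ereal)
qed

lemma J_inf_step:
  assumes wp: "well_posed f Y \<beta> c x" "well_posed f Y \<beta> c (f x (u 0))"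
    and u: "u \<in> admissible f Y x"
  shows "J_inf f \<beta> c x u =
    ereal (c x (u 0)) + ereal \<beta> * J_inf f \<beta> c (f x (u 0)) (\<lambda>k. u (Suc k))"
proof -
  let ?x' = "f x (u 0)" and ?u' = "\<lambda>k. u (Suc k)"
  define S where "S n = (\<Sum>k<n. \<beta> ^ k * c (traj f u x k) (u k))" for n
  define S' where "S' n = (\<Sum>k<n. \<beta> ^ k * c (traj f ?u' ?x' k) (?u' k))" for n
  have "?u' \<in> admissible f Y ?x'"
    using admissible_shift[OF u, of 1] by simp
  then have "(\<lambda>n. ereal (S' n)) \<longlonglongrightarrow> J_inf f \<beta> c ?x' ?u'"
    unfolding S'_def by (rule well_posed_LIMSEQ[OF wp(2)])
  \<comment> \<open>Adding a real and multiplying by a real constant stay continuous at infinite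
    limits, so a tail of infinite cost needs no separate case.\<close>
  then have "(\<lambda>n. ereal (c x (u 0)) + ereal \<beta> * ereal (S' n))
      \<longlonglongrightarrow> ereal (c x (u 0)) + ereal \<beta> * J_inf f \<beta> c ?x' ?u'"
    by (intro tendsto_add_ereal_general tendsto_cmult_ereal tendsto_const) auto
  moreover have "ereal (S (Suc n)) = ereal (c x (u 0)) + ereal \<beta> * ereal (S' n)" for n
    by (simp add: S_def S'_def sum.lessThan_Suc_shift traj_tail sum_distrib_left mult.assoc
        del: sum.lessThan_Suc traj.simps(2))
  moreover have "(\<lambda>n. ereal (S (Suc n))) \<longlonglongrightarrow> J_inf f \<beta> c x u"
    using well_posed_LIMSEQ[OF wp(1) u] unfolding S_def by (rule LIMSEQ_Suc)
  ultimately show ?thesis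
    using LIMSEQ_unique by simp
qed

text \<open>One half of Bellman's principle: \<open>a\<close> followed by an optimal control for
  \<open>f x a\<close> is a competitor at \<open>x\<close>.\<close>

lemma V_inf_le_step:
  assumes wp: "well_posed f Y \<beta> c x" "well_posed f Y \<beta> c (f x a)" and Y: "(x, a) \<in> Y"
  shows "V_inf f Y \<beta> c x \<le> ereal (c x a) + ereal \<beta> * V_inf f Y \<beta> c (f x a)"
proof -
  obtain v where v: "v \<in> admissible f Y (f x a)" "J_inf f \<beta> c (f x a) v = V_inf f Y \<beta> c (f x a)"
    using well_posed_optimal[OF wp(2)] .
  have adm: "case_nat a v \<in> admissible f Y x"
    using Y v(1) by (rule admissible_case_nat)
  then have "V_inf f Y \<beta> c x \<le> J_inf f \<beta> c x (case_nat a v)"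
    by (rule V_inf_le_J_inf)
  also have "\<dots> = ereal (c x a) + ereal \<beta> * V_inf f Y \<beta> c (f x a)"
    using J_inf_step[of f Y \<beta> c x "case_nat a v"] wp adm v(2) by simp
  finally show ?thesis .
qed

section \<open>Comparison of the rotated and the original problem\<close>

lemma sum_rotated_cost:
  assumes "\<beta> \<noteq> 1"
  shows "(\<Sum>k<n. \<beta> ^ k * rotated_cost f \<beta> l lam xl ul (traj f u x k) (u k)) =
    (\<Sum>k<n. \<beta> ^ k * l (traj f u x k) (u k)) - l xl ul * (1 - \<beta> ^ n) / (1 - \<beta>)
      + lam x - \<beta> ^ n * lam (traj f u x n)"
  using assms by (induction n) (simp_all add: rotated_cost_def field_simps)

text \<open>The remainder left by telescoping; \<open>m\<close> will be a lower bound of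
  \<open>lam\<close>, or 0.\<close>

lemma LIMSEQ_discounted_const:
  fixes \<beta> c d m :: real
  assumes "0 < \<beta>" "\<beta> < 1"
  shows "(\<lambda>n. d - c * (1 - \<beta> ^ n) / (1 - \<beta>) - \<beta> ^ n * m) \<longlonglongrightarrow> d - c / (1 - \<beta>)"
proof -
  have "(\<lambda>n. d - c * (1 - \<beta> ^ n) / (1 - \<beta>) - \<beta> ^ n * m)
      \<longlonglongrightarrow> d - c * (1 - 0) / (1 - \<beta>) - 0 * m"
    using assms by (intro tendsto_intros LIMSEQ_power_zero) auto
  then show ?thesis by simp
qed

text \<open>The end term of the telescoped sum is at most \<open>- \<beta> ^ n * m\<close> for a
  lower bound \<open>m\<close> of \<open>lam\<close>. This tends to 0, so the limit of the end term
  itself is not involved.\<close>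

lemma J_inf_rotated_le:
  fixes f :: "'x \<Rightarrow> 'u \<Rightarrow> 'x" and l :: "'x \<Rightarrow> 'u \<Rightarrow> real" and lam :: "'x \<Rightarrow> real"
    and \<beta> :: real and xl :: 'x and ul :: 'u
  defines "lt \<equiv> rotated_cost f \<beta> l lam xl ul"
  assumes \<beta>: "0 < \<beta>" "\<beta> < 1"
    and wp: "well_posed f Y \<beta> l x" "well_posed f Y \<beta> lt x"
    and u: "u \<in> admissible f Y x"
    and bdd: "bdd_below (lam ` state_set Y)"
  shows "J_inf f \<beta> lt x u \<le> J_inf f \<beta> l x u + ereal (lam x - l xl ul / (1 - \<beta>))"
proof -
  define S where "S n = (\<Sum>k<n. \<beta> ^ k * l (traj f u x k) (u k))" for n
  define St where "St n = (\<Sum>k<n. \<beta> ^ k * lt (traj f u x k) (u k))" for n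
  obtain m where m: "\<And>y. y \<in> state_set Y \<Longrightarrow> m \<le> lam y"
    using bdd by (auto simp: bdd_below_def)
  let ?r = "\<lambda>n. lam x - l xl ul * (1 - \<beta> ^ n) / (1 - \<beta>) - \<beta> ^ n * m"
  have le: "St n \<le> S n + ?r n" for n
  proof -
    have "\<beta> ^ n * m \<le> \<beta> ^ n * lam (traj f u x n)"
      using \<beta> m[OF admissible_traj_state_set[OF u]] by (intro mult_left_mono) auto
    then show ?thesis
      using \<beta> unfolding St_def S_def lt_def by (simp add: sum_rotated_cost)
  qed
  have "(\<lambda>n. ereal (S n) + ereal (?r n))
      \<longlonglongrightarrow> J_inf f \<beta> l x u + ereal (lam x - l xl ul / (1 - \<beta>))"
    using well_posed_LIMSEQ[OF wp(1) u] LIMSEQ_discounted_const[OF \<beta>]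
    unfolding S_def by (intro tendsto_add_ereal_general tendsto_ereal) auto
  moreover have "(\<lambda>n. ereal (St n)) \<longlonglongrightarrow> J_inf f \<beta> lt x u"
    unfolding St_def by (rule well_posed_LIMSEQ[OF wp(2) u])
  ultimately show ?thesis
    using le by (intro LIMSEQ_le) auto
qed

lemma J_inf_rotated_eq:
  fixes f :: "'x \<Rightarrow> 'u \<Rightarrow> 'x" and l :: "'x \<Rightarrow> 'u \<Rightarrow> real" and lam :: "'x \<Rightarrow> real"
    and \<beta> :: real and xl :: 'x and ul :: 'u
  defines "lt \<equiv> rotated_cost f \<beta> l lam xl ul"
  assumes \<beta>: "0 < \<beta>" "\<beta> < 1"
    and wp: "well_posed f Y \<beta> l x" "well_posed f Y \<beta> lt x"
    and u: "u \<in> admissible f Y x"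
    and lim: "(\<lambda>k. \<beta> ^ k * lam (traj f u x k)) \<longlonglongrightarrow> 0"
  shows "J_inf f \<beta> lt x u = J_inf f \<beta> l x u + ereal (lam x - l xl ul / (1 - \<beta>))"
proof -
  define S where "S n = (\<Sum>k<n. \<beta> ^ k * l (traj f u x k) (u k))" for n
  define St where "St n = (\<Sum>k<n. \<beta> ^ k * lt (traj f u x k) (u k))" for n
  let ?r = "\<lambda>n. lam x - l xl ul * (1 - \<beta> ^ n) / (1 - \<beta>) - \<beta> ^ n * lam (traj f u x n)"
  have "?r \<longlonglongrightarrow> lam x - l xl ul / (1 - \<beta>)"
    using tendsto_diff[OF LIMSEQ_discounted_const[OF \<beta>, of "lam x" "l xl ul" 0] lim] by simp
  then have "(\<lambda>n. ereal (S n) + ereal (?r n))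
      \<longlonglongrightarrow> J_inf f \<beta> l x u + ereal (lam x - l xl ul / (1 - \<beta>))"
    using well_posed_LIMSEQ[OF wp(1) u]
    unfolding S_def by (intro tendsto_add_ereal_general tendsto_ereal) auto
  moreover have "(\<lambda>n. ereal (St n)) \<longlonglongrightarrow> J_inf f \<beta> lt x u"
    unfolding St_def by (rule well_posed_LIMSEQ[OF wp(2) u])
  moreover have "ereal (St n) = ereal (S n) + ereal (?r n)" for n
    using \<beta> unfolding St_def S_def lt_def by (simp add: sum_rotated_cost)
  ultimately show ?thesis
    using LIMSEQ_unique by simp
qed

lemma stage_cost_le_J_inf:
  assumes \<beta>: "0 < \<beta>"
    and wp: "well_posed f Y \<beta> c x" and u: "u \<in> admissible f Y x"
    and nonneg: "\<And>k. 0 \<le> c (traj f u x k) (u k)"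
  shows "ereal (c x (u 0)) \<le> J_inf f \<beta> c x u"
proof (rule LIMSEQ_le_const[OF LIMSEQ_Suc[OF well_posed_LIMSEQ[OF wp u]]], intro exI allI impI)
  fix n
  have "0 \<le> (\<Sum>k<n. \<beta> ^ Suc k * c (traj f u x (Suc k)) (u (Suc k)))"
    using \<beta> nonneg by (intro sum_nonneg mult_nonneg_nonneg) (auto simp del: traj.simps)
  then show "ereal (c x (u 0)) \<le> ereal (\<Sum>k<Suc n. \<beta> ^ k * c (traj f u x k) (u k))"
    by (simp add: sum.lessThan_Suc_shift del: sum.lessThan_Suc traj.simps(2))
qed

text \<open>Each inequality tests one problem with a minimizer of the other. For the rotated
  minimizer the costs must agree exactly, which is where \<open>lim\<close> enters.\<close>

lemma V_inf_rotated_eq: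
  fixes f :: "'x \<Rightarrow> 'u \<Rightarrow> 'x" and l :: "'x \<Rightarrow> 'u \<Rightarrow> real" and lam :: "'x \<Rightarrow> real"
    and \<beta> :: real and xl :: 'x and ul :: 'u
  defines "lt \<equiv> rotated_cost f \<beta> l lam xl ul"
  assumes \<beta>: "0 < \<beta>" "\<beta> < 1"
    and wp: "well_posed f Y \<beta> l x" "well_posed f Y \<beta> lt x"
    and lim: "\<And>u. optimal f Y \<beta> lt x u \<Longrightarrow> (\<lambda>k. \<beta> ^ k * lam (traj f u x k)) \<longlonglongrightarrow> 0"
    and bdd: "bdd_below (lam ` state_set Y)"
  shows "V_inf f Y \<beta> lt x = V_inf f Y \<beta> l x + ereal (lam x - l xl ul / (1 - \<beta>))"
proof (rule antisym)
  obtain u where u: "u \<in> admissible f Y x" "J_inf f \<beta> l x u = V_inf f Y \<beta> l x"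
    using well_posed_optimal[OF wp(1)] .
  show "V_inf f Y \<beta> lt x \<le> V_inf f Y \<beta> l x + ereal (lam x - l xl ul / (1 - \<beta>))"
    using V_inf_le_J_inf[OF u(1), of \<beta> lt] J_inf_rotated_le[OF \<beta> wp[unfolded lt_def] u(1) bdd]
    by (simp add: u(2) lt_def)
next
  obtain v where v: "v \<in> admissible f Y x" "J_inf f \<beta> lt x v = V_inf f Y \<beta> lt x"
    using well_posed_optimal[OF wp(2)] .
  then have "optimal f Y \<beta> lt x v"
    by (simp add: optimal_def)
  then have "V_inf f Y \<beta> lt x = J_inf f \<beta> l x v + ereal (lam x - l xl ul / (1 - \<beta>))"
    using J_inf_rotated_eq[OF \<beta> wp[unfolded lt_def] v(1) lim] v(2) by (simp add: lt_def)
  then show "V_inf f Y \<beta> l x + ereal (lam x - l xl ul / (1 - \<beta>)) \<le> V_inf f Y \<beta> lt x"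
    using V_inf_le_J_inf[OF v(1), of \<beta> l] by (simp add: add_right_mono)
qed


section \<open>Contraction of the rotated value function and counting of far times\<close>

theorem theorem4p3:
  fixes f :: "'x::real_normed_vector \<Rightarrow> 'u::real_normed_vector \<Rightarrow> 'x"
    and Y :: "('x \<times> 'u) set"
    and l :: "'x \<Rightarrow> 'u \<Rightarrow> real"
    and lam :: "'x \<Rightarrow> real"
    and \<beta> C :: real
    and xl :: 'x and ul :: 'u
    and XN Xinv :: "'x set"
    and \<alpha>V :: "real \<Rightarrow> real"
  defines "lt \<equiv> rotated_cost f \<beta> l lam xl ul"
  assumes beta: "0 < \<beta>" "\<beta> < 1"
    and nonempty: "\<forall>x0\<in>state_set Y. admissible f Y x0 \<noteq> {}"
    and dissipative:
      "loc_disc_strictly_dissipative f Y \<beta> xl ul (\<lambda>x u. l x u - l xl ul) XN lam"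
    and Xinv_subset: "Xinv \<subseteq> XN"
    and well_posed: "\<forall>x0\<in>Xinv. well_posed f Y \<beta> l x0 \<and> well_posed f Y \<beta> lt x0"
    and transversality:
      "\<forall>x0\<in>Xinv. \<forall>u. optimal f Y \<beta> lt x0 u \<longrightarrow>
         (\<lambda>k. \<beta> ^ k * lam (traj f u x0 k)) \<longlonglongrightarrow> 0"
    and invariant:
      "\<forall>x0\<in>Xinv. \<forall>u. optimal f Y \<beta> l x0 u \<longrightarrow> (\<forall>k. traj f u x0 k \<in> Xinv)"
    and alphaV: "\<alpha>V \<in> class_K_inf"
    and C: "1 \<le> C" "C < 1 / (1 - \<beta>)"
    and V_le_alphaV: "\<forall>x\<in>Xinv. V_inf f Y \<beta> lt x \<le> ereal (\<alpha>V (norm (x - xl)))"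
    and V_le_C_inf:
      "\<forall>x\<in>Xinv. V_inf f Y \<beta> lt x \<le> ereal C * (INF u\<in>rotated_controls f Y x. ereal (lt x u))"
  shows "turnpike_on f Y \<beta> l xl Xinv"
proof -
  have bdd: "bdd_below (lam ` state_set Y)"
    using dissipative by (simp add: loc_disc_strictly_dissipative_def)
  obtain \<alpha> where \<alpha>: "\<alpha> \<in> class_K_inf"
    and diss: "\<And>x u. \<lbrakk>x \<in> XN; u \<in> rotated_controls f Y x\<rbrakk> \<Longrightarrow> \<alpha> (norm (x - xl)) \<le> lt x u"
    using dissipative unfolding loc_disc_strictly_dissipative_def rotated_controls_def lt_def
      rotated_cost_def by blast
  have \<alpha>_nonneg: "0 \<le> \<alpha> r" if "0 \<le> r" for r
    using \<alpha> that by (auto simp: class_K_inf_def)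
  have wp: "well_posed f Y \<beta> l x" "well_posed f Y \<beta> lt x" if "x \<in> Xinv" for x
    using well_posed that by auto
  have V_eq: "V_inf f Y \<beta> lt x = V_inf f Y \<beta> l x + ereal (lam x - l xl ul / (1 - \<beta>))"
    if x: "x \<in> Xinv" for x
    unfolding lt_def
    using beta wp[OF x, unfolded lt_def] _ bdd
    by (rule V_inf_rotated_eq) (use transversality x in \<open>simp add: lt_def\<close>)
  \<comment> \<open>Invariance of \<open>Xinv\<close> is given for minimizers of the original
    problem, so dissipativity is applied along such a minimizer; by \<open>V_eq\<close> its rotated
    cost is at most the rotated value.\<close>
  have V_ge: "ereal (\<alpha> (norm (x - xl))) \<le> V_inf f Y \<beta> lt x" if x: "x \<in> Xinv" for x
  proof -
    obtain u where u: "u \<in> admissible f Y x" "J_inf f \<beta> l x u = V_inf f Y \<beta> l x"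
      using well_posed_optimal[OF wp(1)[OF x]] .
    have inv: "traj f u x k \<in> Xinv" for k
      using invariant x u by (simp add: optimal_def)
    have lt_ge: "\<alpha> (norm (traj f u x k - xl)) \<le> lt (traj f u x k) (u k)" for k
      using diss inv Xinv_subset admissible_rotated_controls[OF u(1)] by blast
    have "ereal (\<alpha> (norm (x - xl))) \<le> ereal (lt x (u 0))"
      using lt_ge[of 0] by simp
    also have "\<dots> \<le> J_inf f \<beta> lt x u"
      using beta(1) wp(2)[OF x] u(1) order_trans[OF \<alpha>_nonneg lt_ge]
      by (rule stage_cost_le_J_inf) simp
    also have "\<dots> \<le> V_inf f Y \<beta> lt x"
      using J_inf_rotated_le[OF beta wp[OF x, unfolded lt_def] u(1) bdd] u(2)
      by (simp add: V_eq[OF x] flip: lt_def)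
    finally show ?thesis .
  qed
  \<comment> \<open>On \<open>Xinv\<close> the rotated value lies between two reals, so the default
    value of \<open>real_of_ereal\<close> at infinity does not occur there.\<close>
  define W where "W x = real_of_ereal (V_inf f Y \<beta> lt x)" for x
  have W: "V_inf f Y \<beta> lt x = ereal (W x)" if "x \<in> Xinv" for x
    using V_ge[OF that] V_le_alphaV that unfolding W_def
    by (cases "V_inf f Y \<beta> lt x") auto
  have W_ge: "\<alpha> (norm (x - xl)) \<le> W x" and W_le: "W x \<le> \<alpha>V (norm (x - xl))"
    if "x \<in> Xinv" for x
    using V_ge[OF that] V_le_alphaV that W[OF that] by auto
  have W_le_C: "W x \<le> C * lt x u" if "x \<in> Xinv" "u \<in> rotated_controls f Y x" for x u
  proof -
    have "ereal (W x) \<le> ereal C * (INF u\<in>rotated_controls f Y x. ereal (lt x u))"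
      using V_le_C_inf W that by force
    also have "\<dots> \<le> ereal C * ereal (lt x u)"
      using C(1) that(2) by (intro ereal_mult_left_mono INF_lower) auto
    finally show ?thesis by simp
  qed
  \<comment> \<open>Removing a stage cost of at least \<open>W x / C\<close> leaves the share
    \<open>1 - 1 / C\<close> of \<open>W x\<close>; undoing one discount step divides by
    \<open>\<beta>\<close>. The bound \<open>C < 1 / (1 - \<beta>)\<close> says exactly that
    \<open>q < 1\<close>.\<close>
  define q where "q = (1 - 1 / C) / \<beta>"
  have q: "0 \<le> q" "q < 1"
    using beta C by (simp_all add: q_def field_simps)
  \<comment> \<open>The first conjunct passes near-optimality on to the tail, which allows
    iteration; the second is the contraction.\<close>
  have W_step: "J_inf f \<beta> lt (f x (u 0)) (\<lambda>k. u (Suc k)) \<le> ereal (W (f x (u 0)) + \<delta> / \<beta>)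
      \<and> W (f x (u 0)) \<le> q * W x + \<delta> / \<beta>"
    if x: "x \<in> Xinv" and x': "f x (u 0) \<in> Xinv" and u: "u \<in> admissible f Y x"
      and J: "J_inf f \<beta> lt x u \<le> ereal (W x + \<delta>)" for x u \<delta>
  proof -
    let ?x' = "f x (u 0)" and ?u' = "\<lambda>k. u (Suc k)"
    have J_eq: "J_inf f \<beta> lt x u = ereal (lt x (u 0)) + ereal \<beta> * J_inf f \<beta> lt ?x' ?u'"
      using wp(2)[OF x] wp(2)[OF x'] u by (rule J_inf_step)
    have u': "?u' \<in> admissible f Y ?x'"
      using admissible_shift[OF u, of 1] by simp
    then have V': "ereal (W ?x') \<le> J_inf f \<beta> lt ?x' ?u'"
      using V_inf_le_J_inf[of ?u' f Y ?x' \<beta> lt] by (simp add: W[OF x'])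
    \<comment> \<open>The tail cost is bounded below by \<open>W ?x'\<close>, and above because
      \<open>J\<close> bounds the whole cost and \<open>\<beta>\<close> is positive.\<close>
    obtain J' where J': "J_inf f \<beta> lt ?x' ?u' = ereal J'"
      using V' J J_eq beta by (cases "J_inf f \<beta> lt ?x' ?u'") auto
    have le: "lt x (u 0) + \<beta> * J' \<le> W x + \<delta>"
      using J J_eq J' by simp
    have W'_le: "W ?x' \<le> J'"
      using V' J' by simp
    have "(x, u 0) \<in> Y"
      using u by (auto simp: admissible_def dest: spec[of _ 0])
    \<comment> \<open>Bellman's inequality cancels both \<open>W x\<close> and the stage cost in
      \<open>le\<close>, leaving only the error.\<close>
    then have "W x \<le> lt x (u 0) + \<beta> * W ?x'"
      using V_inf_le_step[OF wp(2)[OF x] wp(2)[OF x']] by (simp add: W x x')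
    with le have "\<beta> * J' \<le> \<beta> * W ?x' + \<delta>"
      by simp
    then have "J' \<le> W ?x' + \<delta> / \<beta>"
      using beta by (simp add: field_simps)
    moreover have "\<beta> * W ?x' \<le> (1 - 1 / C) * W x + \<delta>"
    proof -
      have "W x / C \<le> lt x (u 0)"
        using W_le_C[OF x] admissible_rotated_controls[OF u, of 0] C(1)
        by (simp add: field_simps)
      moreover have "\<beta> * W ?x' \<le> \<beta> * J'"
        using beta W'_le by simp
      ultimately show ?thesis
        using le by (simp add: algebra_simps)
    qed
    then have "W ?x' \<le> q * W x + \<delta> / \<beta>"
      using beta by (simp add: q_def field_simps)
    ultimately show ?thesis
      using J' by simp
  qed
  show ?thesis
    unfolding turnpike_on_def
  proof (intro allI impI, elim conjE)
    fix \<epsilon> :: real and Xb :: "'x set"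
    assume \<epsilon>: "0 < \<epsilon>" and Xb: "bounded Xb" "Xb \<subseteq> Xinv"
    obtain R where "\<forall>x\<in>Xb. dist xl x \<le> R"
      using Xb(1) bounded_any_center[of Xb xl] by auto
    \<comment> \<open>The maximum with 0 covers an empty \<open>Xb\<close> with negative
      \<open>R\<close> and keeps the argument of \<open>\<alpha>V\<close> in its domain.\<close>
    then have R: "norm (x - xl) \<le> max R 0" if "x \<in> Xb" for x
      using that by (auto simp: dist_norm norm_minus_commute)
    define B where "B = \<alpha>V (max R 0)"
    have B: "W x \<le> B" if "x \<in> Xb" for x
    proof -
      have "mono_on {0..} \<alpha>V"
        using alphaV by (auto simp: class_K_inf_def intro: strict_mono_on_imp_mono_on)
      then have "\<alpha>V (norm (x - xl)) \<le> B"
        unfolding B_def using R[OF that] by (auto simp: mono_on_def)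
      then show ?thesis
        using W_le[of x] Xb(2) that by auto
    qed
    have B_nonneg: "0 \<le> B"
      using alphaV by (auto simp: B_def class_K_inf_def)
    have \<alpha>_mono: "strict_mono_on {0..} \<alpha>" and "\<alpha> 0 = 0"
      using \<alpha> by (auto simp: class_K_inf_def)
    then have \<alpha>_pos: "0 < \<alpha> \<epsilon>"
      using strict_mono_onD[of "{0..}" \<alpha> 0 \<epsilon>] \<epsilon> by auto
    \<comment> \<open>Half of the threshold \<open>\<alpha> \<epsilon>\<close> goes to the
      contracted initial value, the other half to accumulated errors. Since \<open>q\<close> and
      \<open>B\<close> do not involve \<open>M\<close>, neither does \<open>N\<close>.\<close>
    have "(\<lambda>n. q ^ n * B) \<longlonglongrightarrow> 0 * B"
      using q by (intro tendsto_intros LIMSEQ_power_zero) auto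
    then have "\<forall>\<^sub>F n in sequentially. q ^ n * B < \<alpha> \<epsilon> / 2"
      by (rule order_tendstoD) (use \<alpha>_pos in simp)
    then obtain N where N: "\<And>n. N \<le> n \<Longrightarrow> q ^ n * B < \<alpha> \<epsilon> / 2"
      by (auto simp: eventually_sequentially)
    define P where "P = Suc N"
    have P: "0 < P" "\<And>n. P \<le> n \<Longrightarrow> q ^ n * B < \<alpha> \<epsilon> / 2"
      using N by (simp_all add: P_def)
    have "\<exists>\<delta>>0. \<forall>x0\<in>Xb. \<forall>u\<in>admissible f Y x0.
        J_inf f \<beta> l x0 u \<le> V_inf f Y \<beta> l x0 + ereal \<delta> \<and> (\<forall>k\<in>{0..M}. traj f u x0 k \<in> Xinv)
        \<longrightarrow> card (far_times f xl x0 u \<epsilon> M) \<le> P" for M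
    proof -
      \<comment> \<open>The error allowed per step: \<open>M\<close> of them use at most the second
        half of the threshold. The \<open>+ 1\<close> avoids division by zero for
        \<open>M = 0\<close>.\<close>
      define \<eta> where "\<eta> = \<alpha> \<epsilon> / (2 * (real M + 1))"
      have \<eta>: "0 < \<eta>" "real M * \<eta> \<le> \<alpha> \<epsilon> / 2"
        using \<alpha>_pos by (simp_all add: \<eta>_def field_simps)
      \<comment> \<open>Errors grow like \<open>\<delta> / \<beta> ^ k\<close>; the factor
        \<open>\<beta> ^ M\<close> keeps them below \<open>\<eta>\<close> up to time
        \<open>M\<close>.\<close>
      define \<delta> where "\<delta> = \<beta> ^ M * \<eta>"
      have \<delta>: "0 < \<delta>"
        using beta \<eta> by (simp add: \<delta>_def)
      have \<delta>_le: "\<delta> / \<beta> ^ k \<le> \<eta>" if "k \<le> M" for k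
        using beta \<eta> power_decreasing[OF that, of \<beta>] by (simp add: \<delta>_def field_simps)
      have "card (far_times f xl x0 u \<epsilon> M) \<le> P"
        if x0: "x0 \<in> Xb" and u: "u \<in> admissible f Y x0"
          and J: "J_inf f \<beta> l x0 u \<le> V_inf f Y \<beta> l x0 + ereal \<delta>"
          and inv: "\<forall>k\<in>{0..M}. traj f u x0 k \<in> Xinv" for x0 u
      proof -
        let ?d = "ereal (lam x0 - l xl ul / (1 - \<beta>))"
        have x0': "x0 \<in> Xinv"
          using x0 Xb(2) by auto
        have "J_inf f \<beta> lt x0 u \<le> J_inf f \<beta> l x0 u + ?d"
          unfolding lt_def
          by (rule J_inf_rotated_le[OF beta wp[OF x0', unfolded lt_def] u bdd])
        also have "\<dots> \<le> V_inf f Y \<beta> l x0 + ereal \<delta> + ?d"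
          using J by (rule add_right_mono)
        also have "\<dots> = ereal (W x0 + \<delta>)"
          using V_eq[OF x0'] W[OF x0'] by (simp add: ac_simps flip: plus_ereal.simps(1))
        finally have J0: "J_inf f \<beta> lt x0 u \<le> ereal (W x0 + \<delta>)" .
        \<comment> \<open>Both conjuncts go through the induction together, as the contraction at
          time \<open>k\<close> requires a nearly optimal tail. Old errors are not amplified because
          \<open>q < 1\<close>, so they simply add up.\<close>
        have main: "J_inf f \<beta> lt (traj f u x0 k) (\<lambda>j. u (j + k))
              \<le> ereal (W (traj f u x0 k) + \<delta> / \<beta> ^ k)
            \<and> W (traj f u x0 k) \<le> q ^ k * B + real k * \<eta>" if "k \<le> M" for k
          using that
        proof (induction k)
          case 0
          then show ?case using J0 B[OF x0] by simp
        next
          case (Suc k)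
          then have IH: "J_inf f \<beta> lt (traj f u x0 k) (\<lambda>j. u (j + k))
              \<le> ereal (W (traj f u x0 k) + \<delta> / \<beta> ^ k)"
            "W (traj f u x0 k) \<le> q ^ k * B + real k * \<eta>" by auto
          have "traj f u x0 k \<in> Xinv" "traj f u x0 (Suc k) \<in> Xinv"
            using inv Suc.prems by (auto simp del: traj.simps)
          then have step: "J_inf f \<beta> lt (traj f u x0 (Suc k)) (\<lambda>j. u (j + Suc k))
                \<le> ereal (W (traj f u x0 (Suc k)) + \<delta> / \<beta> ^ Suc k)"
              "W (traj f u x0 (Suc k)) \<le> q * W (traj f u x0 k) + \<delta> / \<beta> ^ Suc k"
            using W_step[OF _ _ admissible_shift[OF u] IH(1)] by (simp_all add: mult.commute)
          have "q * W (traj f u x0 k) \<le> q * (q ^ k * B + real k * \<eta>)"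
            using q IH(2) by (intro mult_left_mono) auto
          moreover have "q * (real k * \<eta>) \<le> real k * \<eta>"
            using q \<eta> by (intro mult_left_le_one_le) auto
          moreover have "\<delta> / \<beta> ^ Suc k \<le> \<eta>"
            using \<delta>_le[OF Suc.prems] .
          ultimately have "W (traj f u x0 (Suc k)) \<le> q ^ Suc k * B + real (Suc k) * \<eta>"
            using step(2) by (simp add: algebra_simps)
          with step(1) show ?case by simp
        qed
        \<comment> \<open>A far time from \<open>P\<close> on would give
          \<open>\<alpha> \<epsilon> \<le> W < \<alpha> \<epsilon>\<close> at the current state.
          Hence all far times lie among the first \<open>P\<close> instants.\<close>
        have "k < P" if k: "k \<in> far_times f xl x0 u \<epsilon> M" for k
        proof (rule ccontr)
          assume "\<not> k < P"
          have kM: "k \<le> M" and far: "\<epsilon> \<le> norm (traj f u x0 k - xl)"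
            using k by (auto simp: far_times_def)
          have "\<alpha> \<epsilon> \<le> \<alpha> (norm (traj f u x0 k - xl))"
            using strict_mono_on_leD[OF \<alpha>_mono _ _ far] \<epsilon> by simp
          also have "\<dots> \<le> W (traj f u x0 k)"
            using W_ge inv kM by simp
          also have "\<dots> \<le> q ^ k * B + real k * \<eta>"
            using main[OF kM] by simp
          also have "\<dots> \<le> q ^ k * B + real M * \<eta>"
            using kM \<eta>(1) by simp
          also have "\<dots> < \<alpha> \<epsilon>"
            using P(2)[of k] \<open>\<not> k < P\<close> \<eta>(2) by simp
          finally show False by simp
        qed
        then have "far_times f xl x0 u \<epsilon> M \<subseteq> {..<P}"
          by auto
        then show ?thesis
          using card_mono[of "{..<P}"] by fastforce
      qed
      with \<delta> show ?thesis by blast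
    qed
    with P(1) show "\<exists>P::nat. P > 0 \<and> (\<forall>M::nat. \<exists>\<delta>::real. \<delta> > 0 \<and>
         (\<forall>x0\<in>Xb. \<forall>u\<in>admissible f Y x0.
            J_inf f \<beta> l x0 u \<le> V_inf f Y \<beta> l x0 + ereal \<delta> \<and>
            (\<forall>k\<in>{0..M}. traj f u x0 k \<in> Xinv) \<longrightarrow>
            card (far_times f xl x0 u \<epsilon> M) \<le> P))" by blast
  qed
qed

end
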